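(* Let $G$ be a finite, simple, connected graph with order $n(G)$ and clique number $\omega(G)$. If $n(G) \geq \omega(G) + 1 \geq 4$, then $$\dim_{l}(G) \leq \left\lfloor \left(\frac{\omega(G) - 2}{\omega(G) - 1}\right) n(G)\right\rfloor .$$
   Context: For a finite, simple, connected graph $G$ with vertex set $V(G)$, $n(G)=|V(G)|$ denotes its order, $\omega(G)$ its clique number (the largest number of pairwise adjacent vertices), and $d_G(u,v)$ the length of a shortest path between vertices $u$ and $v$. A vertex $w$ distinguishes $u$ and $v$ if $d_G(u,w)\neq d_G(v,w)$. For $S \subseteq V(G)$ let $\overline{S} = V(G)\setminus S$. The set $S$ is a local resolving set of $G$ if any two adjacent vertices from $\overline{S}$ are distinguished by a vertex from $S$. The local metric dimension $\dim_l(G)$ is the cardinality of a smallest local resolving set of $G$. *)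

theory Defs
  imports Complex_Main "Graph_Theory.Graph_Theory"
begin

definition graph_order :: "('a, 'b) pre_digraph \<Rightarrow> nat" where
  "graph_order G = card (verts G)"

definition clique :: "('a, 'b) pre_digraph \<Rightarrow> 'a set \<Rightarrow> bool" where
  "clique G K \<longleftrightarrow> K \<subseteq> verts G \<and> (\<forall>u\<in>K. \<forall>v\<in>K. u \<noteq> v \<longrightarrow> u \<rightarrow>\<^bsub>G\<^esub> v)"

definition clique_number :: "('a, 'b) pre_digraph \<Rightarrow> nat" where
  "clique_number G = Max (card ` {K. clique G K})"

text \<open>The value of \<open>graph_dist G u v\<close> is meaningful only if \<open>v\<close> is reachable from \<open>u\<close>;
  for the connected graphs considered here this is the case for all vertices.\<close>

definition graph_dist :: "('a, 'b) pre_digraph \<Rightarrow> 'a \<Rightarrow> 'a \<Rightarrow> nat" where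
  "graph_dist G u v = (LEAST k. \<exists>p. pre_digraph.apath G u p v \<and> length p = k)"

text \<open>Agreement with the library's shortest-path cost for unit weights, which is an
  extended real and an infimum over walks.\<close>

lemma (in fin_digraph) graph_dist_eq_mu:
  assumes "u \<rightarrow>\<^sup>* v"
  shows "\<mu> (\<lambda>_. 1) u v = ereal (real (graph_dist G u v))"
proof -
  have cost: "awalk_cost (\<lambda>_. 1) p = real (length p)" for p :: "'b list"
    by (induction p) auto
  have "\<exists>k p. apath u p v \<and> length p = k"
    using assms reachable_apath by blast
  then have "\<exists>p. apath u p v \<and> length p = graph_dist G u v"
    unfolding graph_dist_def by (rule LeastI_ex)
  then obtain p where p: "apath u p v" "length p = graph_dist G u v"
    by blast
  have min: "graph_dist G u v \<le> length q" if "apath u q v" for q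
    unfolding graph_dist_def using that by (auto intro: Least_le)
  obtain q where q: "apath u q v" "\<mu> (\<lambda>_. 1) u v = awalk_cost (\<lambda>_. 1) q"
    using min_cost_awalk[OF assms, of "\<lambda>_. 1"] by auto
  have "\<mu> (\<lambda>_. 1) u v \<le> ereal (real (graph_dist G u v))"
    using min_cost_le_walk_cost[OF awalkI_apath[OF p(1)], of "\<lambda>_. 1"] p(2)
    by (simp add: cost)
  then show ?thesis
    using q min[OF q(1)] by (simp add: cost)
qed

definition distinguishes :: "('a, 'b) pre_digraph \<Rightarrow> 'a \<Rightarrow> 'a \<Rightarrow> 'a \<Rightarrow> bool" where
  "distinguishes G w u v \<longleftrightarrow> graph_dist G u w \<noteq> graph_dist G v w"

definition local_resolving_set :: "('a, 'b) pre_digraph \<Rightarrow> 'a set \<Rightarrow> bool" where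
  "local_resolving_set G S \<longleftrightarrow> S \<subseteq> verts G \<and>
     (\<forall>u\<in>verts G - S. \<forall>v\<in>verts G - S. u \<rightarrow>\<^bsub>G\<^esub> v \<longrightarrow> (\<exists>w\<in>S. distinguishes G w u v))"

definition local_metric_dim :: "('a, 'b) pre_digraph \<Rightarrow> nat" where
  "local_metric_dim G = Min (card ` {S. local_resolving_set G S})"

end

theory Submission
  imports Defs
begin

text \<open>Write \<open>k\<close> for the clique number. It suffices to find a set \<open>T\<close> with at least \<open>n / (k - 1)\<close> vertices
such that any two adjacent vertices of \<open>T\<close> are told apart by a vertex outside \<open>T\<close> that is
adjacent to exactly one of them: such a vertex has distance 1 to one and not to the other, so the
complement of \<open>T\<close> is a local resolving set.

The engine is a greedy partition into cliques. If \<open>Q\<close> is a maximal clique of what is left, put one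
\<open>t \<in> Q\<close> into \<open>T\<close> and the rest of \<open>Q\<close> outside. Every vertex \<open>v\<close> that is left over misses some
vertex of \<open>Q\<close>, and if \<open>v\<close> is adjacent to \<open>t\<close> then the missed vertex is not \<open>t\<close> and tells
\<open>t\<close> and \<open>v\<close> apart. All choices made in this way are therefore compatible with each other. A
clique of size at most \<open>k - 1\<close> yields the required density, a \<open>k\<close>-clique falls short by one.

The deficit of the \<open>k\<close>-cliques is repaired by connectedness, which is used in the form that the
remaining graph has no component that is a \<open>k\<close>-clique. Removing a piece \<open>P\<close> may create such
components, but each of them is then attached to \<open>P\<close>; if it is attached to a vertex of \<open>P\<close> outside
\<open>T\<close>, that vertex separates two of its vertices, so the component can contribute two vertices to
\<open>T\<close>, which is a surplus. This is the content of \<open>extend_seed\<close>, and it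
settles every maximal clique that is smaller than \<open>k\<close> or whose removal creates such a component.
What is left (\<open>tight\<close>) are graphs in which all maximal cliques have size \<open>k\<close> and no removal
of one of them creates a clique component. There two intersecting \<open>k\<close>-cliques \<open>Q\<close> and \<open>Q'\<close> are
removed together. If they share at least two vertices, their union has at most \<open>2 (k - 1)\<close>
vertices and can afford a vertex from each of \<open>Q - Q'\<close> and \<open>Q' - Q\<close> in \<open>T\<close>
(\<open>densely_resolvable_thick_pair\<close>); if all intersecting \<open>k\<close>-cliques share just one vertex, that
vertex can be added as a third one (\<open>densely_resolvable_thin_pair\<close>).\<close>

section \<open>Separation by adjacency\<close>

definition resolves :: "('a \<Rightarrow> 'a \<Rightarrow> bool) \<Rightarrow> 'a set \<Rightarrow> 'a \<Rightarrow> 'a \<Rightarrow> bool" where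
  "resolves E S u v \<longleftrightarrow> (\<exists>s\<in>S. E u s \<noteq> E v s)"

definition complete_on :: "('a \<Rightarrow> 'a \<Rightarrow> bool) \<Rightarrow> 'a set \<Rightarrow> bool" where
  "complete_on E K \<longleftrightarrow> (\<forall>u\<in>K. \<forall>v\<in>K. u \<noteq> v \<longrightarrow> E u v)"

lemma resolves_mono: "resolves E S u v \<Longrightarrow> S \<subseteq> S' \<Longrightarrow> resolves E S' u v"
  unfolding resolves_def by blast

lemma resolves_commute: "resolves E S u v \<Longrightarrow> resolves E S v u"
  unfolding resolves_def by blast

definition maximal_clique :: "('a \<Rightarrow> 'a \<Rightarrow> bool) \<Rightarrow> 'a set \<Rightarrow> 'a set \<Rightarrow> bool" where
  "maximal_clique E R Q \<longleftrightarrow> Q \<subseteq> R \<and> complete_on E Q \<and> (\<forall>v\<in>R - Q. \<exists>q\<in>Q. \<not> E v q)"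

text \<open>A seed is a piece of the graph on \<open>R\<close> that can be split off: whatever happens in \<open>R - P\<close>, the
vertices in \<open>P - T\<close> already take care of all pairs with a member in \<open>T\<close>.\<close>

definition seed :: "('a \<Rightarrow> 'a \<Rightarrow> bool) \<Rightarrow> 'a set \<Rightarrow> 'a set \<Rightarrow> 'a set \<Rightarrow> bool" where
  "seed E R P T \<longleftrightarrow> T \<subseteq> P \<and> P \<subseteq> R \<and>
     (\<forall>t\<in>T. \<forall>v\<in>T \<union> (R - P). E t v \<longrightarrow> resolves E (P - T) t v)"

lemma seed_antimono:
  assumes "seed E R P T" "T' \<subseteq> T"
  shows "seed E R P T'"
proof -
  have "resolves E (P - T') t v" if "t \<in> T'" "v \<in> T' \<union> (R - P)" "E t v" for t v
  proof -
    have "t \<in> T" "v \<in> T \<union> (R - P)" using that assms(2) by auto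
    then have "resolves E (P - T) t v" using assms(1) that(3) unfolding seed_def by metis
    then show ?thesis by (rule resolves_mono) (use assms(2) in blast)
  qed
  moreover have "T' \<subseteq> P" "P \<subseteq> R" using assms unfolding seed_def by auto
  ultimately show ?thesis unfolding seed_def by simp
qed

section \<open>Graphs of bounded clique number\<close>

locale bounded_cliques =
  fixes E :: "'a \<Rightarrow> 'a \<Rightarrow> bool" and k :: nat
  assumes sym: "E u v \<Longrightarrow> E v u"
    and irrefl: "\<not> E u u"
    and k_ge_3: "3 \<le> k"
    and card_clique_le: "finite K \<Longrightarrow> complete_on E K \<Longrightarrow> card K \<le> k"
begin

text \<open>The connected components of the graph on \<open>R\<close> that are cliques of the maximum size \<open>k\<close>. They are
the obstruction: such a component needs \<open>k - 1\<close> of its own vertices outside \<open>T\<close>.\<close>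

definition clique_components :: "'a set \<Rightarrow> 'a set set" where
  "clique_components R =
     {C. C \<subseteq> R \<and> card C = k \<and> complete_on E C \<and> (\<forall>u\<in>C. \<forall>v\<in>R - C. \<not> E u v)}"

definition densely_resolvable :: "'a set \<Rightarrow> bool" where
  "densely_resolvable R \<longleftrightarrow> (\<exists>T\<subseteq>R. card R \<le> (k - 1) * card T \<and>
     (\<forall>u\<in>T. \<forall>v\<in>T. E u v \<longrightarrow> resolves E (R - T) u v))"

lemma finite_clique_components: "finite R \<Longrightarrow> finite (clique_components R)"
  unfolding clique_components_def by (rule finite_subset[of _ "Pow R"]) auto

lemma finite_of_card_k: "card C = k \<Longrightarrow> finite C"
  using k_ge_3 by (metis card.infinite not_numeral_le_zero)

lemma non_neighbour:
  assumes "card Q = k" "complete_on E Q" "v \<notin> Q"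
  shows "\<exists>q\<in>Q. \<not> E v q"
proof (rule ccontr)
  assume "\<not> ?thesis"
  then have "complete_on E (insert v Q)"
    using assms(2) sym unfolding complete_on_def by blast
  moreover have "finite Q" using assms(1) by (rule finite_of_card_k)
  ultimately show False
    using card_clique_le[of "insert v Q"] assms by simp
qed

lemma maximal_clique_of_card:
  "Q \<subseteq> R \<Longrightarrow> complete_on E Q \<Longrightarrow> card Q = k \<Longrightarrow> maximal_clique E R Q"
  unfolding maximal_clique_def using non_neighbour[of Q] by simp

lemma maximal_clique_extends:
  assumes "finite R" "K \<subseteq> R" "complete_on E K"
  obtains Q where "K \<subseteq> Q" "maximal_clique E R Q"
proof -
  define F where "F = {Q. Q \<subseteq> R \<and> complete_on E Q}"
  have "finite F" using assms(1) unfolding F_def by (auto intro: finite_subset[of _ "Pow R"])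
  moreover have "K \<in> F" using assms unfolding F_def by blast
  ultimately obtain Q where Q: "Q \<in> F" "K \<subseteq> Q" "\<forall>Q'\<in>F. Q \<subseteq> Q' \<longrightarrow> Q = Q'"
    using finite_has_maximal2[of F K] by blast
  have "\<exists>q\<in>Q. \<not> E v q" if "v \<in> R - Q" for v
  proof (rule ccontr)
    assume "\<not> ?thesis"
    then have "complete_on E (insert v Q)"
      using Q(1) sym unfolding F_def complete_on_def by blast
    then have "insert v Q \<in> F" using Q(1) that unfolding F_def by blast
    then have "Q = insert v Q" using Q(3) by blast
    then show False using that by blast
  qed
  then show ?thesis using that Q(1,2) unfolding F_def maximal_clique_def by blast
qed

lemma clique_components_apart:
  assumes C: "C \<in> clique_components R" and D: "D \<in> clique_components R" and "C \<noteq> D"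
  shows "C \<inter> D = {}" and "c \<in> C \<Longrightarrow> d \<in> D \<Longrightarrow> \<not> E c d"
proof -
  have cC: "card C = k" "complete_on E C" "C \<subseteq> R" "\<And>u v. u \<in> C \<Longrightarrow> v \<in> R - C \<Longrightarrow> \<not> E u v"
    and cD: "card D = k" "D \<subseteq> R" "\<And>u v. u \<in> D \<Longrightarrow> v \<in> R - D \<Longrightarrow> \<not> E u v"
    using C D unfolding clique_components_def by auto
  show *: "C \<inter> D = {}"
  proof (rule ccontr)
    assume "C \<inter> D \<noteq> {}"
    then obtain x where x: "x \<in> C" "x \<in> D" by blast
    have "\<not> C \<subseteq> D"
      using \<open>C \<noteq> D\<close> cC(1) cD(1) card_subset_eq[OF finite_of_card_k[OF cD(1)]] by metis
    then obtain y where y: "y \<in> C" "y \<notin> D" by blast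
    then have "E x y" using x cC(2) unfolding complete_on_def by metis
    moreover have "y \<in> R - D" using y cC(3) by blast
    ultimately show False using cD(3)[OF x(2)] by blast
  qed
  show "\<not> E c d" if "c \<in> C" "d \<in> D" for c d
  proof -
    have "d \<in> R - C" using * that cD(2) by blast
    then show ?thesis by (rule cC(4)[OF that(1)])
  qed
qed

lemma clique_component_attached:
  assumes "D \<in> clique_components (R - P)" "D \<notin> clique_components R"
  shows "\<exists>d\<in>D. \<exists>p\<in>P. E d p"
  using assms unfolding clique_components_def by blast

section \<open>Splitting off a piece and the clique components it leaves\<close>

text \<open>Each clique component \<open>D\<close> left by \<open>P\<close> contributes two vertices: a vertex \<open>s \<in> P - T\<close> attached to
\<open>D\<close> is adjacent to some \<open>a \<in> D\<close>, but not to all of \<open>D\<close> because \<open>D\<close> has the maximum clique size,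
so \<open>s\<close> separates \<open>a\<close> from some \<open>b \<in> D\<close>. Vertices of \<open>D\<close> have no neighbours in the rest of
\<open>R - P\<close>, so no new conflicts arise, and the rest inherits the absence of clique components. The
size condition is the density \<open>1 / (k - 1)\<close> for \<open>P\<close> together with its clique components.\<close>

lemma extend_seed:
  assumes fin: "finite R" and seed: "seed E R P T" and ne: "P \<noteq> {}"
    and att: "\<And>D. D \<in> clique_components (R - P) \<Longrightarrow> \<exists>d\<in>D. \<exists>s\<in>P - T. E d s"
    and size: "card P + k * card (clique_components (R - P))
        \<le> (k - 1) * (card T + 2 * card (clique_components (R - P)))"
    and IH: "\<And>R'. R' \<subset> R \<Longrightarrow> clique_components R' = {} \<Longrightarrow> densely_resolvable R'"
  shows "densely_resolvable R"
proof -
  define \<D> where "\<D> = clique_components (R - P)"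
  have TP: "T \<subseteq> P" and PR: "P \<subseteq> R"
    and sT: "\<And>t v. t \<in> T \<Longrightarrow> v \<in> T \<union> (R - P) \<Longrightarrow> E t v \<Longrightarrow> resolves E (P - T) t v"
    using seed unfolding seed_def by auto
  have finP: "finite P" using fin PR finite_subset by blast
  have D: "D \<subseteq> R - P" "card D = k" "complete_on E D" "\<And>u v. u \<in> D \<Longrightarrow> v \<in> (R - P) - D \<Longrightarrow> \<not> E u v"
    if "D \<in> \<D>" for D
    using that unfolding \<D>_def clique_components_def by auto
  have fD: "finite \<D>" using finite_clique_components fin unfolding \<D>_def by simp
  have disj: "A \<inter> B = {}" and nadj: "\<And>a b. a \<in> A \<Longrightarrow> b \<in> B \<Longrightarrow> \<not> E a b"
    if "A \<in> \<D>" "B \<in> \<D>" "A \<noteq> B" for A B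
    using clique_components_apart[of A "R - P" B] that unfolding \<D>_def by auto
  have "\<exists>e. e \<subseteq> D \<and> card e = 2 \<and> (\<forall>u\<in>e. \<forall>v\<in>e. u \<noteq> v \<longrightarrow> resolves E (P - T) u v)"
    if DD: "D \<in> \<D>" for D
  proof -
    obtain a s where a: "a \<in> D" "s \<in> P - T" "E a s"
      using att[OF DD[unfolded \<D>_def]] by blast
    have "s \<notin> D" using D(1)[OF DD] a(2) by blast
    then obtain b where b: "b \<in> D" "\<not> E s b"
      using non_neighbour[OF D(2)[OF DD] D(3)[OF DD]] by blast
    have nbs: "\<not> E b s" using b(2) sym by blast
    then have "a \<noteq> b" using a(3) by blast
    moreover have "resolves E (P - T) a b"
      using a(2,3) nbs unfolding resolves_def by blast
    moreover from this have "resolves E (P - T) b a" by (rule resolves_commute)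
    ultimately show ?thesis using a(1) b(1) by (intro exI[of _ "{a, b}"]) auto
  qed
  then obtain e where e: "\<And>D. D \<in> \<D> \<Longrightarrow> e D \<subseteq> D" "\<And>D. D \<in> \<D> \<Longrightarrow> card (e D) = 2"
    "\<And>D u v. D \<in> \<D> \<Longrightarrow> u \<in> e D \<Longrightarrow> v \<in> e D \<Longrightarrow> u \<noteq> v \<Longrightarrow> resolves E (P - T) u v"
    by metis
  define U where "U = \<Union>(e ` \<D>)"
  define R' where "R' = R - P - \<Union>\<D>"
  have UD: "U \<subseteq> \<Union>\<D>" using e(1) unfolding U_def by blast
  have DR: "\<Union>\<D> \<subseteq> R - P" using D(1) by blast
  have cU: "card U = 2 * card \<D>"
  proof -
    have "card U = (\<Sum>D\<in>\<D>. card (e D))" unfolding U_def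
    proof (rule card_UN_disjoint[OF fD])
      show "\<forall>D\<in>\<D>. finite (e D)" using e(2) by (auto intro: card_ge_0_finite)
      show "\<forall>A\<in>\<D>. \<forall>B\<in>\<D>. A \<noteq> B \<longrightarrow> e A \<inter> e B = {}" using e(1) disj by blast
    qed
    then show ?thesis using e(2) by simp
  qed
  have cD: "card (\<Union>\<D>) = k * card \<D>"
  proof -
    have "card (\<Union>\<D>) = (\<Sum>D\<in>\<D>. card D)"
      by (rule card_Union_disjoint)
        (use D(2) disj finite_of_card_k in \<open>auto simp: pairwise_def disjnt_def\<close>)
    then show ?thesis using D(2) by simp
  qed
  have "clique_components R' = {}"
  proof (rule ccontr)
    assume "clique_components R' \<noteq> {}"
    then obtain C where C: "C \<in> clique_components R'" by blast
    have "\<not> E u v" if uC: "u \<in> C" and vC: "v \<in> (R - P) - C" for u v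
    proof (cases "v \<in> R'")
      case True
      then show ?thesis using C uC vC unfolding clique_components_def by blast
    next
      case False
      then obtain D0 where D0: "D0 \<in> \<D>" "v \<in> D0" using vC unfolding R'_def by blast
      moreover have "u \<in> (R - P) - D0"
        using C uC D0 unfolding clique_components_def R'_def by blast
      ultimately have "\<not> E v u" using D(4) by blast
      then show ?thesis using sym by blast
    qed
    then have "C \<in> \<D>" using C unfolding \<D>_def clique_components_def R'_def by blast
    moreover have "C \<inter> \<Union>\<D> = {}" using C unfolding clique_components_def R'_def by blast
    ultimately have "C = {}" by blast
    then show False using C k_ge_3 unfolding clique_components_def by simp
  qed
  moreover have "R' \<subset> R" using ne PR unfolding R'_def by blast
  ultimately have "densely_resolvable R'" by (rule IH[rotated])
  then obtain T' where T': "T' \<subseteq> R'" "card R' \<le> (k - 1) * card T'"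
    "\<And>u v. u \<in> T' \<Longrightarrow> v \<in> T' \<Longrightarrow> E u v \<Longrightarrow> resolves E (R' - T') u v"
    unfolding densely_resolvable_def by blast
  let ?T = "T \<union> U \<union> T'"
  have sub: "P - T \<subseteq> R - ?T" "R' - T' \<subseteq> R - ?T"
    using TP PR UD DR T'(1) unfolding R'_def by blast+
  have finU: "finite U" "finite (\<Union>\<D>)" "finite T'" "finite T"
  proof -
    show fDD: "finite (\<Union>\<D>)" by (rule finite_subset[OF DR]) (use fin in simp)
    show "finite U" by (rule finite_subset[OF UD fDD])
    show "finite T'" by (rule finite_subset[OF T'(1)]) (use fin in \<open>simp add: R'_def\<close>)
    show "finite T" by (rule finite_subset[OF TP finP])
  qed
  have cT: "card ?T = card T + 2 * card \<D> + card T'"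
  proof -
    have "card (T \<union> U) = card T + card U"
      using finU UD DR TP by (intro card_Un_disjoint) auto
    moreover have "card ?T = card (T \<union> U) + card T'"
      using finU UD DR TP T'(1) unfolding R'_def by (intro card_Un_disjoint) auto
    ultimately show ?thesis using cU by simp
  qed
  have cR: "card R = card P + k * card \<D> + card R'"
  proof -
    have "R = P \<union> \<Union>\<D> \<union> R'" using PR DR unfolding R'_def by blast
    moreover have "card (P \<union> \<Union>\<D>) = card P + card (\<Union>\<D>)"
      using finP finU DR by (intro card_Un_disjoint) auto
    moreover have "card (P \<union> \<Union>\<D> \<union> R') = card (P \<union> \<Union>\<D>) + card R'"
      using finP finU fin unfolding R'_def by (intro card_Un_disjoint) auto
    ultimately show ?thesis using cD by metis
  qed
  have one: "resolves E (R - ?T) u v" if "u \<in> T" "v \<in> ?T" "E u v" for u v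
  proof -
    have "v \<in> T \<union> (R - P)" using that(2) UD DR T'(1) unfolding R'_def by blast
    from resolves_mono[OF sT[OF that(1) this that(3)] sub(1)] show ?thesis .
  qed
  have two: "resolves E (R - ?T) u v" if u: "u \<in> U" and v: "v \<in> U \<union> T'" and uv: "E u v" for u v
  proof -
    obtain D0 where D0: "D0 \<in> \<D>" "u \<in> e D0" using u unfolding U_def by blast
    have uD: "u \<in> D0" using e(1)[OF D0(1)] D0(2) by blast
    have "v \<in> R - P" using v UD DR T'(1) unfolding R'_def by blast
    then have vD: "v \<in> D0" using D(4)[OF D0(1) uD, of v] uv by blast
    then have "v \<notin> T'" using T'(1) D0(1) unfolding R'_def by blast
    then obtain D1 where D1: "D1 \<in> \<D>" "v \<in> e D1" using v unfolding U_def by blast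
    have "v \<in> D1" using e(1)[OF D1(1)] D1(2) by blast
    then have "D0 = D1" using nadj[OF D0(1) D1(1) _ uD] uv by blast
    moreover have "u \<noteq> v" using uv irrefl by metis
    ultimately have "resolves E (P - T) u v" using e(3)[OF D0] D1(2) by blast
    from resolves_mono[OF this sub(1)] show ?thesis .
  qed
  have "resolves E (R - ?T) u v" if T: "u \<in> ?T" "v \<in> ?T" and uv: "E u v" for u v
  proof -
    have vu: "E v u" using sym[OF uv] .
    consider "u \<in> T" | "v \<in> T" | "u \<in> U" "v \<in> U \<union> T'" | "v \<in> U" "u \<in> U \<union> T'" | "u \<in> T'" "v \<in> T'"
      using T by blast
    then show ?thesis
    proof cases
      case 1 then show ?thesis using one T(2) uv by metis
    next
      case 2 show ?thesis by (rule resolves_commute[OF one[OF 2 T(1) vu]])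
    next
      case 3 then show ?thesis using two[OF _ _ uv] by metis
    next
      case 4 show ?thesis by (rule resolves_commute[OF two[OF 4 vu]])
    next
      case 5 show ?thesis by (rule resolves_mono[OF T'(3)[OF 5 uv] sub(2)])
    qed
  qed
  moreover have "?T \<subseteq> R" using TP PR UD DR T'(1) unfolding R'_def by blast
  moreover have "card R \<le> (k - 1) * card ?T"
    using size T'(2) unfolding cR cT \<D>_def[symmetric] by (simp add: algebra_simps)
  ultimately show ?thesis unfolding densely_resolvable_def by (intro exI[of _ ?T]) simp
qed

section \<open>Splitting off one maximal clique\<close>

text \<open>The greedy principle: a vertex missed by \<open>v\<close> cannot be \<open>t\<close>, since \<open>t\<close> is a neighbour of \<open>v\<close>.\<close>

lemma maximal_clique_resolves:
  assumes Q: "maximal_clique E R Q" and t: "t \<in> Q" and v: "v \<in> R - Q" "E t v"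
  shows "resolves E (Q - {t}) t v"
proof -
  obtain q where q: "q \<in> Q" "\<not> E v q" using Q v(1) unfolding maximal_clique_def by blast
  have "q \<noteq> t" using sym[OF v(2)] q(2) by blast
  then have "E t q" using Q t q(1) unfolding maximal_clique_def complete_on_def by auto
  then show ?thesis using q \<open>q \<noteq> t\<close> unfolding resolves_def by blast
qed

lemma seed_maximal_clique:
  assumes "maximal_clique E R Q" "t \<in> Q"
  shows "seed E R Q {t}"
  using assms maximal_clique_resolves[OF assms] irrefl unfolding seed_def maximal_clique_def by auto

text \<open>Choose an attachment vertex in \<open>Q\<close> for every clique component left by \<open>Q\<close>. If some \<open>t \<in> Q\<close> is not
chosen, it may go into \<open>T\<close>, since all components stay attached to \<open>Q - {t}\<close>. Otherwise there are at
least \<open>card Q\<close> components, and their surplus pays for keeping all of \<open>Q\<close> outside \<open>T\<close>.\<close>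

lemma densely_resolvable_maximal_clique:
  assumes fin: "finite R" and R: "clique_components R = {}"
    and Q: "maximal_clique E R Q" "Q \<noteq> {}"
    and big: "card Q < k \<or> clique_components (R - Q) \<noteq> {}"
    and IH: "\<And>R'. R' \<subset> R \<Longrightarrow> clique_components R' = {} \<Longrightarrow> densely_resolvable R'"
  shows "densely_resolvable R"
proof -
  define \<D> where "\<D> = clique_components (R - Q)"
  have finQ: "finite Q" using Q(1) fin finite_subset unfolding maximal_clique_def by blast
  have cQ: "card Q \<le> k" using card_clique_le finQ Q(1) unfolding maximal_clique_def by blast
  have fD: "finite \<D>" using finite_clique_components fin unfolding \<D>_def by simp
  obtain m where m: "k = m + 3" using k_ge_3 by (metis add.commute le_Suc_ex)
  have "\<forall>D\<in>\<D>. \<exists>p. p \<in> Q \<and> (\<exists>d\<in>D. E d p)"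
    using clique_component_attached R unfolding \<D>_def by blast
  then obtain f where f: "\<And>D. D \<in> \<D> \<Longrightarrow> f D \<in> Q" "\<And>D. D \<in> \<D> \<Longrightarrow> \<exists>d\<in>D. E d (f D)"
    by metis
  show ?thesis
  proof (cases "Q \<subseteq> f ` \<D>")
    case True
    then have le: "card Q \<le> card \<D>" using fD by (meson card_image_le card_mono finite_imageI le_trans)
    have size: "card Q + k * card \<D> \<le> (k - 1) * (card ({} :: 'a set) + 2 * card \<D>)"
      using le unfolding m by (simp add: algebra_simps)
    show ?thesis
    proof (rule extend_seed[OF fin _ Q(2) _ _ IH])
      show "seed E R Q {}" using seed_antimono[OF seed_maximal_clique[OF Q(1)]] Q(2) by blast
      show "\<exists>d\<in>D. \<exists>s\<in>Q - {}. E d s" if "D \<in> clique_components (R - Q)" for D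
        using f that unfolding \<D>_def by blast
    qed (use size in \<open>simp_all add: \<D>_def\<close>)
  next
    case False
    then obtain t where t: "t \<in> Q" "t \<notin> f ` \<D>" by blast
    have "card Q < k \<or> 1 \<le> card \<D>" using big fD unfolding \<D>_def[symmetric]
      by (simp add: Suc_le_eq card_gt_0_iff)
    then have size: "card Q + k * card \<D> \<le> (k - 1) * (card {t} + 2 * card \<D>)"
      using cQ unfolding m by (auto simp: algebra_simps)
    show ?thesis
    proof (rule extend_seed[OF fin _ Q(2) _ _ IH])
      show "seed E R Q {t}" by (rule seed_maximal_clique) fact+
      show "\<exists>d\<in>D. \<exists>s\<in>Q - {t}. E d s" if "D \<in> clique_components (R - Q)" for D
        using f that t(2) unfolding \<D>_def by blast
    qed (use size in \<open>simp_all add: \<D>_def\<close>)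
  qed
qed

section \<open>Splitting off two intersecting cliques\<close>

text \<open>The graphs in which splitting off a single maximal clique always has density \<open>1 / k\<close> only.\<close>

definition tight :: "'a set \<Rightarrow> bool" where
  "tight R \<longleftrightarrow> clique_components R = {} \<and>
     (\<forall>Q. maximal_clique E R Q \<longrightarrow> card Q = k \<and> clique_components (R - Q) = {})"

text \<open>Without an edge to \<open>Q - Q'\<close>, the component would already appear when only \<open>Q'\<close> is removed.\<close>

lemma attached_outside:
  assumes "tight R" "maximal_clique E R Q'" "D \<in> clique_components (R - (Q \<union> Q'))"
  shows "\<exists>d\<in>D. \<exists>p\<in>Q - Q'. E d p"
proof (rule clique_component_attached)
  have "R - Q' - (Q - Q') = R - (Q \<union> Q')" by blast
  then show "D \<in> clique_components (R - Q' - (Q - Q'))" using assms(3) by simp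
  show "D \<notin> clique_components (R - Q')" using assms(1,2) unfolding tight_def by blast
qed

lemma maximal_clique_card_Diff:
  assumes "tight R" "maximal_clique E R Q" "maximal_clique E R Q'" "Q \<noteq> Q'"
  shows "Q - Q' \<noteq> {}"
proof
  assume "Q - Q' = {}"
  moreover have "card Q = k" "card Q' = k" using assms unfolding tight_def by auto
  ultimately show False
    using card_subset_eq[of Q' Q] finite_of_card_k assms(4) by auto
qed

lemma card_pair:
  assumes "tight R" "maximal_clique E R Q" "maximal_clique E R Q'"
  shows "card (Q \<union> Q') + card (Q \<inter> Q') = 2 * k"
proof -
  have "card Q = k" "card Q' = k" using assms unfolding tight_def by auto
  moreover from this have "finite Q" "finite Q'" by (auto intro: finite_of_card_k)
  ultimately show ?thesis using card_Un_Int[of Q Q'] by simp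
qed

text \<open>As \<open>x \<notin> Q'\<close>, all of \<open>Q' - {z}\<close> stays outside \<open>T\<close>, and symmetrically, so both cliques retain their
full separating power.\<close>

lemma seed_pair:
  assumes Q: "maximal_clique E R Q" "maximal_clique E R Q'" and x: "x \<in> Q - Q'" and z: "z \<in> Q' - Q"
  shows "seed E R (Q \<union> Q') {x, z}"
proof -
  have "resolves E (Q \<union> Q' - {x, z}) x v" if v: "v \<in> R - Q" "E x v" for v
    using maximal_clique_resolves[OF Q(1) _ v] x z
    by (auto elim!: resolves_mono)
  moreover have "resolves E (Q \<union> Q' - {x, z}) z v" if v: "v \<in> R - Q'" "E z v" for v
    using maximal_clique_resolves[OF Q(2) _ v] x z
    by (auto elim!: resolves_mono)
  moreover have "Q \<subseteq> R" "Q' \<subseteq> R" using Q unfolding maximal_clique_def by auto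
  ultimately show ?thesis using x z irrefl unfolding seed_def by auto
qed

lemma densely_resolvable_pair_attached:
  assumes fin: "finite R" and tight: "tight R"
    and Q: "maximal_clique E R Q" "maximal_clique E R Q'" and i: "2 \<le> card (Q \<inter> Q')"
    and x: "x \<in> Q - Q'" and z: "z \<in> Q' - Q"
    and att: "\<And>D. D \<in> clique_components (R - (Q \<union> Q')) \<Longrightarrow> \<exists>d\<in>D. \<exists>s\<in>Q \<union> Q' - {x, z}. E d s"
    and IH: "\<And>R'. R' \<subset> R \<Longrightarrow> clique_components R' = {} \<Longrightarrow> densely_resolvable R'"
  shows "densely_resolvable R"
proof -
  obtain m where m: "k = m + 3" using k_ge_3 by (metis add.commute le_Suc_ex)
  have "x \<noteq> z" using x z by blast
  then have "card {x, z} = 2" by simp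
  then have "card (Q \<union> Q') + k * l \<le> (k - 1) * (card {x, z} + 2 * l)" for l
    using card_pair[OF tight Q] i unfolding m by (simp add: algebra_simps)
  note size = this
  show ?thesis
    by (rule extend_seed[OF fin seed_pair[OF Q x z] _ att size IH]) (use x in auto)
qed

text \<open>The exceptional configuration for \<open>k = 3\<close>: the only outside neighbours of the triangle \<open>D\<close> are two
nonadjacent vertices \<open>b\<close> and \<open>w\<close>. Both lie in a triangle that shares an edge with \<open>D\<close>, and these
two edges have a common vertex \<open>c\<close>. Splitting off \<open>D\<close> and the triangle through \<open>b\<close> works, because
every clique component left over must contain \<open>w\<close> and is thus attached to \<open>c\<close>, which is not in \<open>T\<close>.\<close>

lemma densely_resolvable_two_neighbours:
  assumes fin: "finite R" and tight: "tight R" and k: "k = 3"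
    and D: "D \<subseteq> R" "complete_on E D" "card D = k"
    and b: "b \<in> R - D" and w: "w \<in> R - D" and nbw: "\<not> E b w"
    and nbs: "\<And>d v. d \<in> D \<Longrightarrow> v \<in> R - D \<Longrightarrow> E d v \<Longrightarrow> v = b \<or> v = w"
    and att: "\<exists>d\<in>D. E d b" "\<exists>d\<in>D. E d w"
    and IH: "\<And>R'. R' \<subset> R \<Longrightarrow> clique_components R' = {} \<Longrightarrow> densely_resolvable R'"
  shows "densely_resolvable R"
proof -
  have finD: "finite D" using D(3) by (rule finite_of_card_k)
  have mD: "maximal_clique E R D" using D by (intro maximal_clique_of_card)
  have triangle: "\<exists>D'. maximal_clique E R D' \<and> u \<in> D' \<and> D' - {u} \<subseteq> D \<and> card (D \<inter> D') = 2"
    if u: "u \<in> R - D" and nuv: "\<not> E u v" and uv: "{u, v} = {b, w}" and au: "\<exists>d\<in>D. E d u" for u v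
  proof -
    obtain c where c: "c \<in> D" "E c u" using au by blast
    have "complete_on E {c, u}" using c(2) sym unfolding complete_on_def by auto
    then obtain D' where D': "{c, u} \<subseteq> D'" "maximal_clique E R D'"
      using maximal_clique_extends[of R "{c, u}"] fin u c D(1) by auto
    have "y \<in> D" if y: "y \<in> D'" "y \<noteq> u" for y
    proof (rule ccontr)
      assume "y \<notin> D"
      then have "y \<noteq> c" "y \<in> R - D" using c(1) y(1) D'(2) unfolding maximal_clique_def by auto
      moreover have "E c y" "E u y"
        using D' y \<open>y \<noteq> c\<close> unfolding maximal_clique_def complete_on_def by auto
      ultimately have "y \<in> {u, v}" using nbs[OF c(1), of y] uv by auto
      then show False using y(2) nuv \<open>E u y\<close> by auto
    qed
    then have sub: "D' - {u} \<subseteq> D" by blast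
    then have "D \<inter> D' = D' - {u}" using u by blast
    moreover have "card D' = 3" using tight D'(2) k unfolding tight_def by auto
    ultimately have "card (D \<inter> D') = 2" using D'(1) by simp
    then show ?thesis using D' sub by auto
  qed
  obtain D' where D': "maximal_clique E R D'" "b \<in> D'" "D' - {b} \<subseteq> D" "card (D \<inter> D') = 2"
    using triangle[OF b nbw _ att(1)] by auto
  have nwb: "\<not> E w b" using nbw sym by blast
  obtain D'' where D'': "maximal_clique E R D''" "w \<in> D''" "card (D \<inter> D'') = 2"
    using triangle[OF w nwb _ att(2)] by auto
  have "D \<inter> D' \<inter> D'' \<noteq> {}"
  proof
    assume "D \<inter> D' \<inter> D'' = {}"
    then have "card ((D \<inter> D') \<union> (D \<inter> D'')) = 4"
      using D'(4) D''(3) finD by (subst card_Un_disjoint) auto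
    moreover have "card ((D \<inter> D') \<union> (D \<inter> D'')) \<le> card D"
      using finD by (intro card_mono) auto
    ultimately show False using D(3) k by simp
  qed
  then obtain c where c: "c \<in> D" "c \<in> D'" "c \<in> D''" by blast
  have Ewc: "E w c"
    using D''(1,2) c w unfolding maximal_clique_def complete_on_def by auto
  obtain e where e: "e \<in> D - D'"
    using maximal_clique_card_Diff[OF tight mD D'(1)] b D'(2) by blast
  show ?thesis
  proof (rule densely_resolvable_pair_attached[OF fin tight mD D'(1) _ e _ _ IH])
    show "2 \<le> card (D \<inter> D')" using D'(4) by simp
    show "b \<in> D' - D" using b D'(2) by blast
    show "\<exists>d\<in>C. \<exists>s\<in>D \<union> D' - {e, b}. E d s" if C: "C \<in> clique_components (R - (D \<union> D'))" for C
    proof -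
      obtain f p where f: "f \<in> C" "p \<in> D - D'" "E f p"
        using attached_outside[OF tight D'(1) C] by blast
      have "f \<in> R - (D \<union> D')" using C f(1) unfolding clique_components_def by blast
      then have "f = w" using nbs[of p f] f(2) sym[OF f(3)] D'(2) by auto
      then show ?thesis using f(1) Ewc c e b by auto
    qed
  qed
qed

text \<open>With \<open>i\<close> common vertices the union has \<open>2 k - i\<close> vertices and can afford two in \<open>T\<close>. This works
directly if \<open>x\<close> and \<open>z\<close> can be chosen such that every clique component left over is attached to
another vertex of the union. If not, take only \<open>z\<close>; every component is attached to \<open>Q - Q'\<close>, and
the surplus of the components pays for the loss unless there is only one of them and \<open>i = 2\<close>. In
that case the component \<open>D\<close> defeats every choice of \<open>x\<close> and \<open>z\<close>, so there is only one choice,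
whence \<open>k = 3\<close> and the exceptional configuration is present.\<close>

lemma densely_resolvable_thick_pair:
  assumes fin: "finite R" and tight: "tight R"
    and Q: "maximal_clique E R Q" "maximal_clique E R Q'" "Q \<noteq> Q'" and i: "2 \<le> card (Q \<inter> Q')"
    and IH: "\<And>R'. R' \<subset> R \<Longrightarrow> clique_components R' = {} \<Longrightarrow> densely_resolvable R'"
  shows "densely_resolvable R"
proof (rule ccontr)
  assume contra: "\<not> densely_resolvable R"
  define P where "P = Q \<union> Q'"
  obtain m where m: "k = m + 3" using k_ge_3 by (metis add.commute le_Suc_ex)
  have PR: "P \<subseteq> R" using Q unfolding P_def maximal_clique_def by blast
  have unatt: "\<exists>D \<in> clique_components (R - P). \<forall>d\<in>D. \<forall>s\<in>P - {x, z}. \<not> E d s"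
    if "x \<in> Q - Q'" "z \<in> Q' - Q" for x z
    using densely_resolvable_pair_attached[OF fin tight Q(1,2) i that _ IH] contra
    unfolding P_def by blast
  obtain b where b: "b \<in> Q - Q'" using maximal_clique_card_Diff[OF tight Q] by blast
  obtain w where w: "w \<in> Q' - Q"
    using maximal_clique_card_Diff[OF tight Q(2,1)] Q(3) by blast
  obtain D where D: "D \<in> clique_components (R - P)" "\<And>d s. d \<in> D \<Longrightarrow> s \<in> P - {b, w} \<Longrightarrow> \<not> E d s"
    using unatt[OF b w] by blast
  let ?l = "card (clique_components (R - P))"
  have l: "1 \<le> ?l"
    using D(1) finite_clique_components[of "R - P"] fin by (simp add: Suc_le_eq card_gt_0_iff) blast
  \<comment> \<open>Otherwise the choice \<open>T = {w}\<close> has sufficient density.\<close>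
  have "\<not> (2 \<le> ?l \<or> 3 \<le> card (Q \<inter> Q'))"
  proof
    assume big: "2 \<le> ?l \<or> 3 \<le> card (Q \<inter> Q')"
    have arith: "card P + k * n \<le> (k - 1) * (card {w} + 2 * n)"
      if "2 \<le> n \<or> 3 \<le> card (Q \<inter> Q')" "1 \<le> n" for n
    proof -
      have "m \<le> m * n" using that(2) by simp
      moreover have "k * n = m * n + 3 * n" "(k - 1) * (card {w} + 2 * n) = m + 2 + 2 * (m * n) + 4 * n"
        unfolding m by (simp_all add: algebra_simps)
      moreover have "card P + card (Q \<inter> Q') = 2 * m + 6"
        using card_pair[OF tight Q(1,2)] unfolding m P_def by simp
      ultimately show ?thesis using i that by linarith
    qed
    have "densely_resolvable R"
    proof (rule extend_seed[OF fin _ _ _ arith[OF big l] IH])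
      show "seed E R P {w}"
        unfolding P_def by (rule seed_antimono[OF seed_pair[OF Q(1,2) b w]]) simp
      show "P \<noteq> {}" using b unfolding P_def by blast
      show "\<exists>d\<in>C. \<exists>s\<in>P - {w}. E d s" if "C \<in> clique_components (R - P)" for C
      proof -
        obtain d p where "d \<in> C" "p \<in> Q - Q'" "E d p"
          using attached_outside[OF tight Q(2)] \<open>C \<in> _\<close> unfolding P_def by blast
        moreover from this have "p \<in> P - {w}" using w unfolding P_def by auto
        ultimately show ?thesis by blast
      qed
    qed
    then show False using contra by contradiction
  qed
  then have l1: "?l = 1" and i2: "card (Q \<inter> Q') = 2" using l i by auto
  \<comment> \<open>As \<open>D\<close> is the only component, it is the one that is unattached for every choice of \<open>x\<close> and \<open>z\<close>.\<close>
  have uniq: "C = D" if "C \<in> clique_components (R - P)" for C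
    using l1 D(1) that by (auto simp: card_1_singleton_iff)
  have attb: "\<exists>d\<in>D. E d b"
  proof -
    obtain d p where dp: "d \<in> D" "p \<in> Q - Q'" "E d p"
      using attached_outside[OF tight Q(2) D(1)[unfolded P_def]] by blast
    then have "p \<notin> P - {b, w}" using D(2) by blast
    then have "p = b" using dp(2) w unfolding P_def by auto
    then show ?thesis using dp by blast
  qed
  have attw: "\<exists>d\<in>D. E d w"
  proof -
    have "Q' \<union> Q = P" unfolding P_def by blast
    then obtain d p where dp: "d \<in> D" "p \<in> Q' - Q" "E d p"
      using attached_outside[OF tight Q(1), of D Q'] D(1) by auto
    then have "p \<notin> P - {b, w}" using D(2) by blast
    then have "p = w" using dp(2) b unfolding P_def by auto
    then show ?thesis using dp by blast
  qed
  have "x = b" if x: "x \<in> Q - Q'" for x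
  proof (rule ccontr)
    assume "x \<noteq> b"
    then have "b \<in> P - {x, w}" using b w unfolding P_def by blast
    moreover obtain C where "C \<in> clique_components (R - P)" "\<forall>d\<in>C. \<forall>s\<in>P - {x, w}. \<not> E d s"
      using unatt[OF x w] by blast
    ultimately show False using uniq[of C] attb by blast
  qed
  then have "Q - Q' = {b}" using b by blast
  then have Qb: "Q = insert b (Q \<inter> Q')" by blast
  have "x = w" if x: "x \<in> Q' - Q" for x
  proof (rule ccontr)
    assume "x \<noteq> w"
    then have "w \<in> P - {b, x}" using b w unfolding P_def by blast
    moreover obtain C where "C \<in> clique_components (R - P)" "\<forall>d\<in>C. \<forall>s\<in>P - {b, x}. \<not> E d s"
      using unatt[OF b x] by blast
    ultimately show False using uniq[of C] attw by blast
  qed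
  then have "Q' - Q = {w}" using w by blast
  then have Qw: "Q' = insert w (Q \<inter> Q')" by blast
  have cQ: "card Q = k" "card Q' = k" using tight Q unfolding tight_def by auto
  have "card Q = Suc (card (Q \<inter> Q'))"
  proof -
    have "card (insert b (Q \<inter> Q')) = Suc (card (Q \<inter> Q'))"
      using b finite_of_card_k[OF cQ(1)] by (intro card_insert_disjoint) auto
    then show ?thesis using Qb by simp
  qed
  then have k3: "k = 3" using cQ i2 by simp
  have nbw: "\<not> E b w"
  proof
    assume "E b w"
    have "E b q" if "q \<in> Q'" for q
    proof (cases "q = w")
      case False
      then have "q \<in> Q" using that Qw by blast
      then show ?thesis using that b Q(1) unfolding maximal_clique_def complete_on_def by auto
    qed (use \<open>E b w\<close> in simp)
    moreover have "complete_on E Q'" using Q(2) unfolding maximal_clique_def by blast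
    ultimately show False using non_neighbour[of Q' b] b cQ by blast
  qed
  have DR: "D \<subseteq> R - P" "card D = k" "complete_on E D"
    "\<And>d v. d \<in> D \<Longrightarrow> v \<in> (R - P) - D \<Longrightarrow> \<not> E d v"
    using D(1) unfolding clique_components_def by auto
  have "densely_resolvable R"
  proof (rule densely_resolvable_two_neighbours[OF fin tight k3 _ DR(3,2) _ _ nbw _ attb attw IH])
    show "D \<subseteq> R" using DR(1) by blast
    show "b \<in> R - D" "w \<in> R - D" using b w DR(1) PR unfolding P_def by auto
    show "v = b \<or> v = w" if "d \<in> D" "v \<in> R - D" "E d v" for d v
      using D(2)[of d v] DR(4)[of d v] that by blast
  qed
  then show False using contra by contradiction
qed

text \<open>If no vertex has two neighbours in a maximal clique that avoids it, then \<open>T\<close> may contain the common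
vertex \<open>a\<close> besides \<open>x \<in> Q\<close> and \<open>z \<in> Q'\<close>: any further vertex of \<open>Q\<close> separates \<open>x\<close> and \<open>a\<close> from
all their neighbours outside \<open>Q\<close>, and likewise for \<open>Q'\<close>. This gives three vertices out of \<open>2 k - 1\<close>. If clique components are left
over, drop \<open>x\<close>, so that they remain attached to \<open>Q - {a}\<close>, which is outside \<open>T\<close>.\<close>

lemma densely_resolvable_thin_pair:
  assumes fin: "finite R" and tight: "tight R"
    and Q: "maximal_clique E R Q" "maximal_clique E R Q'" and a: "Q \<inter> Q' = {a}"
    and thin: "\<And>C u p q. maximal_clique E R C \<Longrightarrow> u \<in> R - C \<Longrightarrow> p \<in> C \<Longrightarrow> q \<in> C
      \<Longrightarrow> E u p \<Longrightarrow> E u q \<Longrightarrow> p = q"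
    and IH: "\<And>R'. R' \<subset> R \<Longrightarrow> clique_components R' = {} \<Longrightarrow> densely_resolvable R'"
  shows "densely_resolvable R"
proof -
  define P where "P = Q \<union> Q'"
  have cQ: "card Q = k" "card Q' = k" using tight Q unfolding tight_def by auto
  have QR: "Q \<subseteq> R" "Q' \<subseteq> R" using Q unfolding maximal_clique_def by auto
  have two: "\<exists>x s. x \<in> C \<and> s \<in> C \<and> x \<noteq> a \<and> s \<noteq> a \<and> s \<noteq> x" if C: "card C = k" "a \<in> C" for C
  proof -
    have "2 \<le> card (C - {a})" using C k_ge_3 by simp
    then obtain A where "A \<subseteq> C - {a}" "card A = 2"
      by (rule obtain_subset_with_card_n)
    moreover from this obtain x s where "A = {x, s}" "x \<noteq> s" unfolding card_2_iff by blast
    ultimately have "x \<in> C - {a}" "s \<in> C - {a}" "s \<noteq> x" by auto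
    then show ?thesis by blast
  qed
  obtain x s where x: "x \<in> Q" "s \<in> Q" "x \<noteq> a" "s \<noteq> a" "s \<noteq> x" using two[OF cQ(1)] a by blast
  obtain z r where z: "z \<in> Q'" "r \<in> Q'" "z \<noteq> a" "r \<noteq> a" "r \<noteq> z" using two[OF cQ(2)] a by blast
  have out: "x \<notin> Q'" "s \<notin> Q'" "z \<notin> Q" "r \<notin> Q" using x z a by auto
  have aa: "a \<in> Q" "a \<in> Q'" using a by auto
  have splits: "E t y \<and> \<not> E v y"
    if "maximal_clique E R C" "t \<in> C" "y \<in> C" "y \<noteq> t" "v \<in> R - C" "E t v" for C t y v
    using that thin[OF that(1,5,2,3) sym[OF that(6)]]
    unfolding maximal_clique_def complete_on_def by auto
  let ?S = "P - {x, a, z}"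
  have S: "s \<in> ?S" "r \<in> ?S" using x z out unfolding P_def by auto
  have fromQ: "resolves E ?S t v" if "t = x \<or> t = a" "v \<in> R - Q" "E t v" for t v
    using splits[OF Q(1) _ x(2) _ that(2,3)] that(1) x aa S unfolding resolves_def by blast
  have fromQ': "resolves E ?S t v" if "t = z \<or> t = a" "v \<in> R - Q'" "E t v" for t v
    using splits[OF Q(2) _ z(2) _ that(2,3)] that(1) z aa S unfolding resolves_def by blast
  have seed: "seed E R P {x, a, z}"
    unfolding seed_def
  proof (intro conjI ballI impI)
    fix t v assume t: "t \<in> {x, a, z}" and v: "v \<in> {x, a, z} \<union> (R - P)" and tv: "E t v"
    have vt: "E v t" using sym[OF tv] .
    have ne: "t \<noteq> v" using tv irrefl by metis
    have inR: "x \<in> R - Q'" "z \<in> R - Q" using x z out QR by auto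
    consider "t = x \<or> t = a" "v \<in> R - Q" | "t = z \<or> t = a" "v \<in> R - Q'" | "t = x" "v = a" | "t = z" "v = a"
      using t v ne inR unfolding P_def by auto
    then show "resolves E ?S t v"
    proof cases
      case 1 then show ?thesis using fromQ tv by simp
    next
      case 2 then show ?thesis using fromQ' tv by simp
    next
      case 3 then show ?thesis using resolves_commute[OF fromQ'[of a x]] vt inR by simp
    next
      case 4 then show ?thesis using resolves_commute[OF fromQ[of a z]] vt inR by simp
    qed
  qed (use x z aa QR in \<open>auto simp: P_def\<close>)
  obtain m where m: "k = m + 3" using k_ge_3 by (metis add.commute le_Suc_ex)
  have cP: "card P + 1 = 2 * k" using card_pair[OF tight Q] a unfolding P_def by simp
  have Pne: "P \<noteq> {}" using x unfolding P_def by blast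
  let ?l = "card (clique_components (R - P))"
  show ?thesis
  proof (cases "clique_components (R - P) = {}")
    case True
    have "x \<noteq> z" using x(1) out(3) by blast
    then have "card {x, a, z} = 3" using x(3) z(3) by simp
    then have size: "card P + k * ?l \<le> (k - 1) * (card {x, a, z} + 2 * ?l)"
      using cP True unfolding m by simp
    show ?thesis by (rule extend_seed[OF fin seed Pne _ size IH]) (use True in simp)
  next
    case False
    then have "1 \<le> ?l"
      using finite_clique_components[of "R - P"] fin by (simp add: Suc_le_eq card_gt_0_iff)
    moreover have "card P + k * n \<le> (k - 1) * (card {a, z} + 2 * n)" if "1 \<le> n" for n
      using cP that z(3) unfolding m by (simp add: algebra_simps)
    ultimately have size: "card P + k * ?l \<le> (k - 1) * (card {a, z} + 2 * ?l)" by blast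
    show ?thesis
    proof (rule extend_seed[OF fin _ Pne _ size IH])
      show "seed E R P {a, z}" by (rule seed_antimono[OF seed]) blast
      show "\<exists>d\<in>C. \<exists>s\<in>P - {a, z}. E d s" if "C \<in> clique_components (R - P)" for C
      proof -
        obtain d p where "d \<in> C" "p \<in> Q - Q'" "E d p"
          using attached_outside[OF tight Q(2)] \<open>C \<in> _\<close> unfolding P_def by blast
        moreover from this have "p \<in> P - {a, z}" using z(1) aa unfolding P_def by auto
        ultimately show ?thesis by blast
      qed
    qed
  qed
qed

text \<open>In a tight graph a maximal clique \<open>Q\<close> is not a component, hence has an outside neighbour \<open>u\<close>, and
extending \<open>u\<close> with its neighbours in \<open>Q\<close> to a maximal clique yields the second member of the pair.\<close>

lemma densely_resolvable_of_no_clique_component: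
  "finite R \<Longrightarrow> clique_components R = {} \<Longrightarrow> densely_resolvable R"
proof (induction R rule: finite_psubset_induct)
  case (psubset R)
  note fin = psubset.hyps and R = psubset.prems
  have IH: "densely_resolvable R'" if "R' \<subset> R" "clique_components R' = {}" for R'
    using psubset.IH that by blast
  show ?case
  proof (cases "R = {}")
    case True
    then show ?thesis unfolding densely_resolvable_def by simp
  next
    case False
    have ne: "Q \<noteq> {}" if "maximal_clique E R Q" for Q
      using that False unfolding maximal_clique_def by blast
    show ?thesis
    proof (cases "tight R")
      case False
      then obtain Q where Q: "maximal_clique E R Q" "card Q \<noteq> k \<or> clique_components (R - Q) \<noteq> {}"
        using R unfolding tight_def by blast
      have "finite Q" "complete_on E Q"
        using Q(1) fin finite_subset unfolding maximal_clique_def by auto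
      then have "card Q \<le> k" by (rule card_clique_le)
      then have "card Q < k \<or> clique_components (R - Q) \<noteq> {}" using Q(2) by auto
      then show ?thesis by (rule densely_resolvable_maximal_clique[OF fin R Q(1) ne[OF Q(1)] _ IH])
    next
      case tight: True
      show ?thesis
      proof (cases "\<exists>Q u p q. maximal_clique E R Q \<and> u \<in> R - Q \<and> p \<in> Q \<and> q \<in> Q \<and> E u p \<and> E u q \<and> p \<noteq> q")
        case True
        then obtain Q u p q where Q: "maximal_clique E R Q" "u \<in> R - Q" "p \<in> Q" "q \<in> Q"
          and E: "E u p" "E u q" and pq: "p \<noteq> q" by blast
        have "E p q" "Q \<subseteq> R" using Q(1,3,4) pq unfolding maximal_clique_def complete_on_def by auto
        then have "{u, p, q} \<subseteq> R" "complete_on E {u, p, q}"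
          using E sym Q(2-4) unfolding complete_on_def by auto
        then obtain Q' where Q': "{u, p, q} \<subseteq> Q'" "maximal_clique E R Q'"
          using maximal_clique_extends[OF fin] by metis
        have "finite Q" using Q(1) fin finite_subset unfolding maximal_clique_def by blast
        then have "card {p, q} \<le> card (Q \<inter> Q')" using Q' Q(3,4) by (intro card_mono) auto
        then have "2 \<le> card (Q \<inter> Q')" using pq by simp
        moreover have "Q \<noteq> Q'" using Q(2) Q'(1) by blast
        ultimately show ?thesis
          using densely_resolvable_thick_pair[OF fin tight Q(1) Q'(2) _ _ IH] by blast
      next
        case False
        then have thin: "p = q" if "maximal_clique E R C" "u \<in> R - C" "p \<in> C" "q \<in> C" "E u p" "E u q"
          for C u p q using that by metis
        obtain Q where Q: "maximal_clique E R Q"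
          using maximal_clique_extends[OF fin, of "{}"] unfolding complete_on_def by auto
        have "Q \<notin> clique_components R" "card Q = k" using R tight Q unfolding tight_def by auto
        then obtain a w where w: "a \<in> Q" "w \<in> R - Q" "E a w"
          using Q unfolding clique_components_def maximal_clique_def by auto
        have "complete_on E {a, w}" "{a, w} \<subseteq> R"
          using w sym Q unfolding complete_on_def maximal_clique_def by auto
        then obtain Q' where Q': "{a, w} \<subseteq> Q'" "maximal_clique E R Q'"
          using maximal_clique_extends[OF fin] by metis
        have "y = a" if "y \<in> Q \<inter> Q'" for y
        proof -
          have "E w y" using that w Q' unfolding maximal_clique_def complete_on_def by auto
          then show ?thesis using thin[OF Q w(2)] that w(1) sym[OF w(3)] by blast
        qed
        then have "Q \<inter> Q' = {a}" using w(1) Q'(1) by blast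
        then show ?thesis by (rule densely_resolvable_thin_pair[OF fin tight Q Q'(2) _ thin IH])
      qed
    qed
  qed
qed

end

section \<open>Local metric dimension\<close>

lemma graph_dist_eq_1_iff:
  assumes "graph G" and reach: "u \<rightarrow>\<^sup>*\<^bsub>G\<^esub> v"
  shows "graph_dist G u v = 1 \<longleftrightarrow> u \<rightarrow>\<^bsub>G\<^esub> v"
proof -
  interpret graph G by fact
  have "\<exists>d p. apath u p v \<and> length p = d" using reach reachable_apath by blast
  then have "\<exists>p. apath u p v \<and> length p = graph_dist G u v"
    unfolding graph_dist_def by (rule LeastI_ex)
  then obtain p where p: "apath u p v" "length p = graph_dist G u v" by blast
  show ?thesis
  proof
    assume "graph_dist G u v = 1"
    then obtain e where "p = [e]" using p(2) by (auto simp: length_Suc_conv)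
    then show "u \<rightarrow>\<^bsub>G\<^esub> v"
      using p(1) by (auto simp: apath_Cons_iff apath_Nil_iff intro: in_arcs_imp_in_arcs_ends)
  next
    assume uv: "u \<rightarrow>\<^bsub>G\<^esub> v"
    then have "u \<noteq> v" using adj_not_same by blast
    then have "p \<noteq> []" using p(1) by (auto simp: apath_Nil_iff)
    obtain e where e: "e \<in> arcs G" "tail G e = u" "head G e = v"
      using uv by (auto simp: arcs_ends_conv)
    then have "apath u [e] v"
      using \<open>u \<noteq> v\<close> by (auto simp: apath_Cons_iff apath_Nil_iff)
    then have "graph_dist G u v \<le> 1"
      unfolding graph_dist_def by (intro Least_le) auto
    then show "graph_dist G u v = 1" using p(2) \<open>p \<noteq> []\<close> by (cases p) auto
  qed
qed

theorem mainTheorem2: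
  fixes G :: "('a, 'b) pre_digraph"
  assumes "graph G" and "Digraph_Component.connected G"
    and "graph_order G \<ge> clique_number G + 1" and "clique_number G + 1 \<ge> 4"
  shows "int (local_metric_dim G)
    \<le> \<lfloor>(real (clique_number G) - 2) / (real (clique_number G) - 1) * real (graph_order G)\<rfloor>"
proof -
  interpret graph G by fact
  define k where "k = clique_number G"
  define V where "V = verts G"
  define E where "E = (\<lambda>u v. u \<rightarrow>\<^bsub>G\<^esub> v)"
  have k3: "3 \<le> k" using assms(4) unfolding k_def by simp
  have n: "k + 1 \<le> card V" using assms(3) unfolding k_def V_def graph_order_def .
  have finV: "finite V" unfolding V_def by simp
  have reach: "u \<rightarrow>\<^sup>*\<^bsub>G\<^esub> v" if "u \<in> V" "v \<in> V" for u v
    using assms(2) that reachable_mk_symmetric_eq[OF sym_arcs]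
    unfolding connected_def strongly_connected_def V_def by auto
  have E_sym: "E v u" if "E u v" for u v
    using that graph_symmetric unfolding E_def by blast
  have E_V: "u \<in> V" "v \<in> V" if "E u v" for u v
    using that adj_in_verts unfolding E_def V_def by auto
  have clique_le: "card K \<le> k" if K: "complete_on E K" for K
  proof (cases "K \<subseteq> V")
    case True
    then have "clique G K"
      using K unfolding clique_def complete_on_def E_def V_def by blast
    moreover have "finite {K. clique G K}"
      by (rule finite_subset[of _ "Pow V"]) (auto simp: clique_def V_def)
    ultimately show ?thesis unfolding k_def clique_number_def by (intro Max_ge) auto
  next
    case False
    then obtain v where v: "v \<in> K" "v \<notin> V" by blast
    have "w = v" if "w \<in> K" for w
      using K that v E_V(1)[of v w] unfolding complete_on_def by metis
    then have "K = {v}" using v(1) by blast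
    then show ?thesis using k3 by simp
  qed
  interpret bounded_cliques E k
    by unfold_locales (use E_sym adj_not_same k3 clique_le in \<open>auto simp: E_def\<close>)
  \<comment> \<open>A component that is a clique of size \<open>k\<close> would be the whole connected graph, which has more than \<open>k\<close> vertices.\<close>
  have "clique_components V = {}"
  proof (rule ccontr)
    assume "clique_components V \<noteq> {}"
    then obtain C where C: "C \<subseteq> V" "card C = k" "\<And>u v. u \<in> C \<Longrightarrow> v \<in> V - C \<Longrightarrow> \<not> E u v"
      unfolding clique_components_def by blast
    obtain u where u: "u \<in> C" using C(2) k3 by fastforce
    have "C \<noteq> V" using C(2) n by auto
    then obtain v where v: "v \<in> V" "v \<notin> C" using C(1) by blast
    have "u \<rightarrow>\<^sup>*\<^bsub>G\<^esub> v" using reach u v(1) C(1) by blast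
    then have "v \<in> C"
    proof (induction rule: reachable_induct)
      case base
      show ?case by fact
    next
      case (step x y)
      then show ?case using C(3)[of x y] E_V(2)[of x y] unfolding E_def by blast
    qed
    then show False using v(2) by contradiction
  qed
  with finV have "densely_resolvable V" by (rule densely_resolvable_of_no_clique_component)
  then obtain T where T: "T \<subseteq> V" "card V \<le> (k - 1) * card T"
    "\<And>u v. u \<in> T \<Longrightarrow> v \<in> T \<Longrightarrow> E u v \<Longrightarrow> resolves E (V - T) u v"
    unfolding densely_resolvable_def by blast
  have "local_resolving_set G (V - T)"
    unfolding local_resolving_set_def
  proof (intro conjI ballI impI)
    show "V - T \<subseteq> verts G" unfolding V_def by blast
    fix u v assume "u \<in> verts G - (V - T)" "v \<in> verts G - (V - T)" and uv: "u \<rightarrow>\<^bsub>G\<^esub> v"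
    then have u: "u \<in> T" and v: "v \<in> T" unfolding V_def by auto
    then obtain s where s: "s \<in> V - T" "E u s \<noteq> E v s"
      using T(3)[OF u v] uv unfolding E_def resolves_def by blast
    have "u \<in> V" "v \<in> V" using u v T(1) by auto
    then have "graph_dist G u s \<noteq> graph_dist G v s"
      using s graph_dist_eq_1_iff[OF assms(1) reach, of u s] graph_dist_eq_1_iff[OF assms(1) reach, of v s]
      unfolding E_def by auto
    then show "\<exists>w\<in>V - T. distinguishes G w u v" using s(1) unfolding distinguishes_def by blast
  qed
  moreover have "finite {S. local_resolving_set G S}"
    by (rule finite_subset[of _ "Pow V"]) (auto simp: local_resolving_set_def V_def)
  ultimately have "local_metric_dim G \<le> card (V - T)"
    unfolding local_metric_dim_def by (intro Min_le) auto
  also have "card (V - T) = card V - card T"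
    using T(1) finV by (simp add: card_Diff_subset finite_subset)
  finally have d: "real (local_metric_dim G) \<le> real (card V) - real (card T)"
    using card_mono[OF finV T(1)] by linarith
  have "real (card V) \<le> real ((k - 1) * card T)" using T(2) by (rule of_nat_mono)
  then have t: "real (card V) \<le> (real k - 1) * real (card T)" using k3 by (simp add: of_nat_diff)
  have "(real k - 1) * real (local_metric_dim G) \<le> (real k - 1) * (real (card V) - real (card T))"
    using d k3 by (intro mult_left_mono) auto
  also have "\<dots> \<le> (real k - 2) * real (card V)" using t by (simp add: algebra_simps)
  finally have "real (local_metric_dim G) \<le> (real k - 2) / (real k - 1) * real (card V)"
    using k3 by (simp add: field_simps)
  then show ?thesis unfolding le_floor_iff k_def V_def graph_order_def by simp
qed

end
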